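(* Let $t,t'$ be terms of the calculus $\lambda^{in}_\upsilon$ described in the context and $\ell$ an $\mathcal{L}$-type. If $t:\ell$ is derivable and $t\to t'$, then $t':\ell$ is derivable.
   Context: Terms: $t::=\underline{n}\mid\lambda t\mid t\,t\mid t\langle i\rangle\mid t\{t,i\}$ with $n,i\in\mathbb{N}$ (here $t\langle i\rangle$, an "updater", abbreviates the $\lambda\upsilon$ closure $t[\Uparrow^i(\uparrow)]$, and $t\{s,i\}$ abbreviates $t[\Uparrow^i(s/)]$). $\mathcal{L}$-types are finite lists of naturals. Partial merge $\ddagger$: $[]\ddagger \ell=\ell$; $(i::\ell)\ddagger []=i::\ell$; $(i_1::\ell_1)\ddagger(i_2::\ell_2)= i_1::(\ell_1\ddagger(i_2::\ell_2))$ if $i_1<i_2$, $=i_2::((i_1::\ell_1)\ddagger \ell_2)$ if $i_1>i_2$, undefined when the recursion reaches equal heads. Partial decrement $\downarrow$, defined only on lists with all elements $>0$: $\downarrow[]=[]$, $\downarrow((i+1)::\ell)=i::\downarrow\ell$. $\uparrow$ adds $1$ to every element, $\uparrow^i$ is its $i$-fold iterate. For a predicate $p$, $(p\mid\ell)$ is the sublist of elements satisfying $p$; $<i$, $>i$, $\geq i$ denote the predicates $k<i$, $k>i$, $k\geq i$. Typing rules (each applicable only when the lists in its conclusion are defined): (ind) $\underline{n}:[n]$; (abs) if $t:0::\ell$ then $\lambda t:\downarrow\ell$; (app) if $t_1:\ell_1$, $t_2:\ell_2$ then $t_1t_2:\ell_1\ddagger\ell_2$; (upd) if $t:\ell$ then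 $t\langle i\rangle:(<i\mid\ell)\ddagger\uparrow(\geq i\mid\ell)$; (sub$_\in$) if $t_1:\ell_1$, $t_2:\ell_2$ and $i\in\ell_1$ then $t_1\{t_2,i\}:((<i\mid\ell_1)\ddagger\downarrow(>i\mid\ell_1))\ddagger\uparrow^i\ell_2$; (sub$_\notin$) if $t_1:\ell_1$, $t_2:\ell_2$ and $i\notin\ell_1$ then $t_1\{t_2,i\}:(<i\mid\ell_1)\ddagger\downarrow(>i\mid\ell_1)$. The reduction $\to$ is the closure under term contexts of the rules: $(\lambda t_1)t_2\to t_1\{t_2,0\}$; $(t_1t_2)\langle i\rangle\to t_1\langle i\rangle\,t_2\langle i\rangle$; $(t_1t_2)\{t_3,i\}\to t_1\{t_3,i\}\,t_2\{t_3,i\}$; $(\lambda t)\langle i\rangle\to\lambda(t\langle i+1\rangle)$; $(\lambda t_1)\{t_2,i\}\to\lambda(t_1\{t_2,i+1\})$; $\underline{0}\{t,0\}\to t$; $\underline{n+1}\{t,0\}\to\underline{n}$; $\underline{0}\{t,i+1\}\to\underline{0}$; $\underline{n+1}\{t,i+1\}\to\underline{n}\{t,i\}\langle 0\rangle$; $\underline{0}\langle i+1\rangle\to\underline{0}$; $\underline{n+1}\langle i+1\rangle\to\underline{n}\langle i\rangle\langle 0\rangle$; $\underline{n}\langle 0\rangle\to\underline{n+1}$. *)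

theory Defs
  imports Main
begin

text \<open>
  Terms with de Bruijn indices starting at 0. \<open>Upd t i\<close> is the updater, i.e. the
  \<open>\<lambda>\<upsilon>\<close> closure of \<open>t\<close> by the \<open>i\<close>-fold lift of the shift; \<open>Sub t s i\<close> is the closure
  of \<open>t\<close> by the \<open>i\<close>-fold lift of \<open>s/\<close>.
\<close>

datatype trm =
    Ind nat
  | Lam trm
  | App trm trm
  | Upd trm nat
  | Sub trm trm nat

type_synonym ltype = "nat list"

text \<open>Partial operations on types return \<open>None\<close> where they are undefined.\<close>

fun merge :: "ltype \<Rightarrow> ltype \<Rightarrow> ltype option" where
  "merge [] l = Some l"
| "merge (i # l) [] = Some (i # l)"
| "merge (i1 # l1) (i2 # l2) =
     (if i1 < i2 then map_option (Cons i1) (merge l1 (i2 # l2))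
      else if i1 > i2 then map_option (Cons i2) (merge (i1 # l1) l2)
      else None)"

fun decr :: "ltype \<Rightarrow> ltype option" where
  "decr [] = Some []"
| "decr (0 # l) = None"
| "decr (Suc i # l) = map_option (Cons i) (decr l)"

definition incr :: "ltype \<Rightarrow> ltype" where
  "incr l = map Suc l"

text \<open>
  A rule whose conclusion contains partial operations has one premise per
  operation, naming its value; it thus applies only if all of them are defined.
\<close>

inductive typing :: "trm \<Rightarrow> ltype \<Rightarrow> bool" (infix \<open>:\<^sub>L\<close> 50) where
  ind: "Ind n :\<^sub>L [n]"
| abs: "\<lbrakk>t :\<^sub>L 0 # l; decr l = Some l'\<rbrakk> \<Longrightarrow> Lam t :\<^sub>L l'"
| app: "\<lbrakk>t1 :\<^sub>L l1; t2 :\<^sub>L l2; merge l1 l2 = Some l\<rbrakk> \<Longrightarrow> App t1 t2 :\<^sub>L l"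
| upd: "\<lbrakk>t :\<^sub>L l; merge (filter (\<lambda>k. k < i) l) (incr (filter (\<lambda>k. k \<ge> i) l)) = Some l'\<rbrakk>
    \<Longrightarrow> Upd t i :\<^sub>L l'"
| sub_in: "\<lbrakk>t1 :\<^sub>L l1; t2 :\<^sub>L l2; i \<in> set l1;
      decr (filter (\<lambda>k. k > i) l1) = Some d;
      merge (filter (\<lambda>k. k < i) l1) d = Some m;
      merge m ((incr ^^ i) l2) = Some l\<rbrakk>
    \<Longrightarrow> Sub t1 t2 i :\<^sub>L l"
| sub_notin: "\<lbrakk>t1 :\<^sub>L l1; t2 :\<^sub>L l2; i \<notin> set l1;
      decr (filter (\<lambda>k. k > i) l1) = Some d;
      merge (filter (\<lambda>k. k < i) l1) d = Some l\<rbrakk>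
    \<Longrightarrow> Sub t1 t2 i :\<^sub>L l"

inductive root_step :: "trm \<Rightarrow> trm \<Rightarrow> bool" where
  beta: "root_step (App (Lam t1) t2) (Sub t1 t2 0)"
| app_upd: "root_step (Upd (App t1 t2) i) (App (Upd t1 i) (Upd t2 i))"
| app_sub: "root_step (Sub (App t1 t2) t3 i) (App (Sub t1 t3 i) (Sub t2 t3 i))"
| lam_upd: "root_step (Upd (Lam t) i) (Lam (Upd t (i + 1)))"
| lam_sub: "root_step (Sub (Lam t1) t2 i) (Lam (Sub t1 t2 (i + 1)))"
| fvar_sub: "root_step (Sub (Ind 0) t 0) t"
| rvar_sub: "root_step (Sub (Ind (n + 1)) t 0) (Ind n)"
| fvar_lift_sub: "root_step (Sub (Ind 0) t (i + 1)) (Ind 0)"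
| rvar_lift_sub: "root_step (Sub (Ind (n + 1)) t (i + 1)) (Upd (Sub (Ind n) t i) 0)"
| fvar_lift_upd: "root_step (Upd (Ind 0) (i + 1)) (Ind 0)"
| rvar_lift_upd: "root_step (Upd (Ind (n + 1)) (i + 1)) (Upd (Upd (Ind n) i) 0)"
| var_shift: "root_step (Upd (Ind n) 0) (Ind (n + 1))"

inductive red :: "trm \<Rightarrow> trm \<Rightarrow> bool" (infix \<open>\<rightarrow>\<^sub>\<upsilon>\<close> 50) where
  root: "root_step t t' \<Longrightarrow> t \<rightarrow>\<^sub>\<upsilon> t'"
| lam: "t \<rightarrow>\<^sub>\<upsilon> t' \<Longrightarrow> Lam t \<rightarrow>\<^sub>\<upsilon> Lam t'"
| app_left: "t \<rightarrow>\<^sub>\<upsilon> t' \<Longrightarrow> App t s \<rightarrow>\<^sub>\<upsilon> App t' s"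
| app_right: "s \<rightarrow>\<^sub>\<upsilon> s' \<Longrightarrow> App t s \<rightarrow>\<^sub>\<upsilon> App t s'"
| upd: "t \<rightarrow>\<^sub>\<upsilon> t' \<Longrightarrow> Upd t i \<rightarrow>\<^sub>\<upsilon> Upd t' i"
| sub_left: "t \<rightarrow>\<^sub>\<upsilon> t' \<Longrightarrow> Sub t s i \<rightarrow>\<^sub>\<upsilon> Sub t' s i"
| sub_right: "s \<rightarrow>\<^sub>\<upsilon> s' \<Longrightarrow> Sub t s i \<rightarrow>\<^sub>\<upsilon> Sub t s' i"

end

theory Submission
  imports Defs
begin

text \<open>
  Every derivable type is a strictly increasing list, so it amounts to a finite set: merging is
  disjoint union and decrementing is always defined where the rules use it. The type of a
  term is hence determined by the term, as the set of its free indices (an index that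
  occurs only in the argument of an erasing substitution is not free), and derivability is a
  linearity condition on the term. Each reduction step preserves both.
\<close>

text \<open>Guarding the contribution of \<open>s\<close> by \<open>i \<in> fv t\<close> lets one
  \<open>Sub\<close> clause cover both \<open>sub_in\<close> and \<open>sub_notin\<close>. Each
  truncated subtraction comes with \<open>i < k\<close> or \<open>i \<le> k\<close>, so it is
  exact.\<close>

fun fv :: "trm \<Rightarrow> nat set" where
  "fv (Ind n) = {n}"
| "fv (Lam t) = {k. Suc k \<in> fv t}"
| "fv (App t s) = fv t \<union> fv s"
| "fv (Upd t i) = {k. k < i \<and> k \<in> fv t \<or> i < k \<and> k - 1 \<in> fv t}"
| "fv (Sub t s i) = {k. k < i \<and> k \<in> fv t \<or> i \<le> k \<and> Suc k \<in> fv t}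
     \<union> {k. i \<in> fv t \<and> i \<le> k \<and> k - i \<in> fv s}"

text \<open>The indices coming from \<open>t\<close> in \<open>Upd\<close> and \<open>Sub\<close>
  cannot clash among themselves, as they split into those below \<open>i\<close> and those at or
  above it. A clash can arise in \<open>App\<close>, or between \<open>t\<close> and a non-erased
  argument in \<open>Sub\<close>.\<close>

fun linear :: "trm \<Rightarrow> bool" where
  "linear (Ind n) \<longleftrightarrow> True"
| "linear (Lam t) \<longleftrightarrow> linear t \<and> 0 \<in> fv t"
| "linear (App t s) \<longleftrightarrow> linear t \<and> linear s \<and> fv t \<inter> fv s = {}"
| "linear (Upd t i) \<longleftrightarrow> linear t"
| "linear (Sub t s i) \<longleftrightarrow> linear t \<and> linear s \<and>
     {k. k < i \<and> k \<in> fv t \<or> i \<le> k \<and> Suc k \<in> fv t}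
     \<inter> {k. i \<in> fv t \<and> i \<le> k \<and> k - i \<in> fv s} = {}"

section \<open>Type operations as set operations\<close>

lemma merge_SomeD:
  assumes "merge l1 l2 = Some l" "sorted_wrt (<) l1" "sorted_wrt (<) l2"
  shows "sorted_wrt (<) l \<and> set l = set l1 \<union> set l2 \<and> set l1 \<inter> set l2 = {}"
  using assms
proof (induction l1 l2 arbitrary: l rule: merge.induct)
  case (3 i1 l1 i2 l2)
  consider "i1 < i2" | "i2 < i1"
    using "3.prems"(1) by (cases i1 i2 rule: linorder_cases) auto
  then show ?case
  proof cases
    case 1
    then obtain m where "merge l1 (i2 # l2) = Some m" "l = i1 # m"
      using "3.prems"(1) by auto
    with "3.IH"(1)[OF 1] "3.prems"(2,3) 1 show ?thesis
      by auto
  next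
    case 2
    then obtain m where "merge (i1 # l1) l2 = Some m" "l = i2 # m"
      using "3.prems"(1) by auto
    with "3.IH"(2)[OF _ 2] "3.prems"(2,3) 2 show ?thesis
      by auto
  qed
qed auto

lemma merge_defined:
  assumes "set l1 \<inter> set l2 = {}"
  shows "\<exists>l. merge l1 l2 = Some l"
  using assms by (induction l1 l2 rule: merge.induct) (auto simp: linorder_neq_iff)

text \<open>Disjointness makes the merge defined, and strictly increasing lists with the same set
  are equal, so its value can only be \<open>l\<close>.\<close>

lemma merge_eq_Some_iff:
  assumes "sorted_wrt (<) l1" "sorted_wrt (<) l2"
  shows "merge l1 l2 = Some l \<longleftrightarrow>
    sorted_wrt (<) l \<and> set l = set l1 \<union> set l2 \<and> set l1 \<inter> set l2 = {}"
  by (metis assms merge_SomeD merge_defined strict_sorted_equal)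

lemma decr_eq_Some_iff: "decr l = Some l' \<longleftrightarrow> l = map Suc l'"
  by (induction l arbitrary: l' rule: decr.induct) (auto simp: Cons_eq_map_conv)

lemma incr_funpow: "(incr ^^ i) l = map ((+) i) l"
  by (induction i) (auto simp: incr_def comp_def)

lemma set_incr_funpow: "set ((incr ^^ i) l) = {k. i \<le> k \<and> k - i \<in> set l}"
  by (force simp: incr_funpow image_iff)

lemma sorted_wrt_less_map_Suc: "sorted_wrt (<) (map Suc l) \<longleftrightarrow> sorted_wrt (<) l"
  by (simp add: sorted_wrt_map)

lemma sorted_wrt_less_incr_funpow: "sorted_wrt (<) ((incr ^^ i) l) \<longleftrightarrow> sorted_wrt (<) l"
  by (simp add: incr_funpow sorted_wrt_map)

lemma decr_filter_eq_SomeD: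
  assumes "decr (filter (\<lambda>k. k > i) l) = Some d" "sorted_wrt (<) l"
  shows "sorted_wrt (<) d \<and> set d = {k. i \<le> k \<and> Suc k \<in> set l}"
proof -
  from assms(1) have *: "filter (\<lambda>k. k > i) l = map Suc d"
    by (simp add: decr_eq_Some_iff)
  then have "sorted_wrt (<) d"
    using sorted_wrt_filter[OF assms(2), of "\<lambda>k. k > i"] by (simp add: sorted_wrt_less_map_Suc)
  moreover have "k \<in> set d \<longleftrightarrow> i \<le> k \<and> Suc k \<in> set l" for k
  proof -
    have "k \<in> set d \<longleftrightarrow> Suc k \<in> set (map Suc d)"
      by auto
    also have "\<dots> \<longleftrightarrow> Suc k \<in> set (filter (\<lambda>k. k > i) l)"
      by (simp only: *)
    finally show ?thesis
      by auto
  qed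
  ultimately show ?thesis
    by auto
qed

lemma decr_defined:
  assumes "0 \<notin> set l"
  shows "\<exists>d. decr l = Some d"
  using assms by (induction l rule: decr.induct) auto

text \<open>Elements above \<open>i\<close> are positive, so their decrement exists; it stays at or
  above \<open>i\<close> and thus never meets the elements below \<open>i\<close>.\<close>

lemma merge_decr_filter_iff:
  assumes "sorted_wrt (<) l"
  shows "(\<exists>d. decr (filter (\<lambda>k. k > i) l) = Some d \<and> merge (filter (\<lambda>k. k < i) l) d = Some m) \<longleftrightarrow>
    sorted_wrt (<) m \<and> set m = {k. k < i \<and> k \<in> set l \<or> i \<le> k \<and> Suc k \<in> set l}"
proof -
  obtain d where d: "decr (filter (\<lambda>k. k > i) l) = Some d"
    using decr_defined[of "filter (\<lambda>k. k > i) l"] by auto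
  then have sd: "sorted_wrt (<) d" "set d = {k. i \<le> k \<and> Suc k \<in> set l}"
    using decr_filter_eq_SomeD[OF d assms] by auto
  then show ?thesis
    using assms by (auto simp: d merge_eq_Some_iff sorted_wrt_filter)
qed

text \<open>Incrementing moves the elements from \<open>i\<close> on strictly above
  \<open>i\<close>, away from those below \<open>i\<close>, so this merge is always defined.\<close>

lemma merge_incr_filter_iff:
  assumes "sorted_wrt (<) l"
  shows "merge (filter (\<lambda>k. k < i) l) (incr (filter (\<lambda>k. k \<ge> i) l)) = Some m \<longleftrightarrow>
    sorted_wrt (<) m \<and> set m = {k. k < i \<and> k \<in> set l \<or> i < k \<and> k - 1 \<in> set l}"
proof -
  have "set (incr (filter (\<lambda>k. k \<ge> i) l)) = {k. i < k \<and> k - 1 \<in> set l}"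
  proof (intro set_eqI)
    show "k \<in> set (incr (filter (\<lambda>k. k \<ge> i) l)) \<longleftrightarrow> k \<in> {k. i < k \<and> k - 1 \<in> set l}" for k
      by (cases k) (auto simp: incr_def)
  qed
  then show ?thesis
    using assms by (auto simp: merge_eq_Some_iff sorted_wrt_filter sorted_wrt_less_map_Suc incr_def)
qed

section \<open>Typability as linearity\<close>

lemma typing_imp_linear:
  assumes "t :\<^sub>L l"
  shows "linear t \<and> sorted_wrt (<) l \<and> set l = fv t"
  using assms
proof (induction rule: typing.induct)
  case (abs t l l')
  have l: "l = map Suc l'"
    using abs.hyps by (simp add: decr_eq_Some_iff)
  \<comment> \<open>The head \<open>0\<close> is not a successor, so prepending it leaves this set
    unchanged.\<close>
  have "set l' = {k. Suc k \<in> set (0 # l)}"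
    unfolding l by auto
  then have "set l' = fv (Lam t)" "0 \<in> fv t"
    using abs.IH by auto
  then show ?case
    using abs.IH l by (simp add: sorted_wrt_less_map_Suc)
next
  case (app t1 l1 t2 l2 l)
  then show ?case
    by (simp add: merge_eq_Some_iff)
next
  case (upd t l i l')
  then show ?case
    by (simp add: merge_incr_filter_iff)
next
  case (sub_in t1 l1 t2 l2 i d m l)
  have m: "sorted_wrt (<) m" "set m = {k. k < i \<and> k \<in> fv t1 \<or> i \<le> k \<and> Suc k \<in> fv t1}"
    using merge_decr_filter_iff[of l1 i m] sub_in by auto
  then show ?case
    using sub_in by (simp add: merge_eq_Some_iff sorted_wrt_less_incr_funpow set_incr_funpow)
next
  case (sub_notin t1 l1 t2 l2 i d l)
  then show ?case
    using merge_decr_filter_iff[of l1 i l] by auto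
qed auto

text \<open>Finiteness lets \<open>sorted_list_of_set (fv t)\<close> serve as the type of a linear
  \<open>t\<close>.\<close>

lemma finite_fv: "finite (fv t)"
proof (induction t)
  case (Lam t)
  then have "finite (Suc -` fv t)"
    by (simp add: finite_vimageI)
  then show ?case
    by (simp add: vimage_def)
next
  case (Upd t i)
  have "fv (Upd t i) \<subseteq> fv t \<union> Suc ` fv t"
  proof
    show "k \<in> fv t \<union> Suc ` fv t" if "k \<in> fv (Upd t i)" for k
      using that by (cases k) auto
  qed
  with Upd show ?case
    by (meson finite_UnI finite_imageI finite_subset)
next
  case (Sub t s i)
  have "fv (Sub t s i) \<subseteq> fv t \<union> Suc -` fv t \<union> (+) i ` fv s"
    by (auto simp: image_iff intro: le_add_diff_inverse[symmetric])
  with Sub show ?case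
    by (meson finite_UnI finite_imageI finite_vimageI inj_Suc finite_subset)
qed auto

lemma linear_imp_typing:
  assumes "linear t" "sorted_wrt (<) l" "set l = fv t"
  shows "t :\<^sub>L l"
  using assms
proof (induction t arbitrary: l)
  case (Ind n)
  then have "l = [n]"
    using strict_sorted_equal[of "[n]" l] by simp
  then show ?case
    by (simp add: typing.ind)
next
  case (Lam t)
  \<comment> \<open>Undoes the decrement and puts the bound index \<open>0\<close> back in front;
    linearity provides \<open>0 \<in> fv t\<close>.\<close>
  let ?l = "0 # map Suc l"
  have "k \<in> set ?l \<longleftrightarrow> k \<in> fv t" for k
    using Lam.prems by (cases k) auto
  then have "t :\<^sub>L ?l"
    using Lam by (intro Lam.IH) (auto simp: sorted_wrt_less_map_Suc)
  then show ?case
    by (rule typing.abs) (simp add: decr_eq_Some_iff)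
next
  case (App t s)
  let ?l1 = "sorted_list_of_set (fv t)" and ?l2 = "sorted_list_of_set (fv s)"
  have "t :\<^sub>L ?l1" "s :\<^sub>L ?l2"
    using App by (simp_all add: finite_fv)
  moreover have "merge ?l1 ?l2 = Some l"
    using App.prems by (simp add: merge_eq_Some_iff finite_fv)
  ultimately show ?case
    by (rule typing.app)
next
  case (Upd t i)
  let ?l = "sorted_list_of_set (fv t)"
  have "t :\<^sub>L ?l"
    using Upd by (simp add: finite_fv)
  moreover have "merge (filter (\<lambda>k. k < i) ?l) (incr (filter (\<lambda>k. k \<ge> i) ?l)) = Some l"
    using Upd.prems by (simp add: merge_incr_filter_iff finite_fv)
  ultimately show ?case
    by (rule typing.upd)
next
  case (Sub t s i)
  \<comment> \<open>The contribution of \<open>t\<close> to the free indices; its sorted list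
    \<open>?m\<close> is the intermediate merge in \<open>sub_in\<close> and the final type in
    \<open>sub_notin\<close>.\<close>
  let ?A = "{k. k < i \<and> k \<in> fv t \<or> i \<le> k \<and> Suc k \<in> fv t}"
  let ?l1 = "sorted_list_of_set (fv t)" and ?l2 = "sorted_list_of_set (fv s)"
    and ?m = "sorted_list_of_set ?A"
  have ty: "t :\<^sub>L ?l1" "s :\<^sub>L ?l2"
    using Sub by (simp_all add: finite_fv)
  have "finite ?A"
    using finite_fv[of "Sub t s i"] by simp
  then have m: "sorted_wrt (<) ?m" "set ?m = ?A"
    by simp_all
  then obtain d where d: "decr (filter (\<lambda>k. k > i) ?l1) = Some d"
      "merge (filter (\<lambda>k. k < i) ?l1) d = Some ?m"
    using merge_decr_filter_iff[of ?l1 i ?m] by (auto simp: finite_fv)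
  show ?case
  proof (cases "i \<in> fv t")
    case True
    then have "merge ?m ((incr ^^ i) ?l2) = Some l"
      using Sub.prems m
      by (simp add: merge_eq_Some_iff sorted_wrt_less_incr_funpow set_incr_funpow finite_fv)
    with ty d True show ?thesis
      by (auto intro: typing.sub_in simp: finite_fv)
  next
    case False
    \<comment> \<open>Here \<open>s\<close> contributes no index, so \<open>l\<close> and
      \<open>?m\<close> have the same set.\<close>
    then have "l = ?m"
      using Sub.prems m by (intro strict_sorted_equal) auto
    with ty d False show ?thesis
      by (auto intro: typing.sub_notin simp: finite_fv)
  qed
qed

lemma typing_iff_linear: "t :\<^sub>L l \<longleftrightarrow> linear t \<and> sorted_wrt (<) l \<and> set l = fv t"
  using typing_imp_linear linear_imp_typing by blast

section \<open>Invariance under reduction\<close>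

lemma root_step_fv:
  assumes "root_step t t'" "linear t"
  shows "fv t' = fv t"
  using assms(1)
proof cases
  \<comment> \<open>Linearity of \<open>Lam t1\<close> gives \<open>0 \<in> fv t1\<close>, so the
    closure does not erase the indices of \<open>t2\<close>.\<close>
  case (beta t1 t2)
  with assms(2) show ?thesis
    by simp
next
  case (lam_upd t i)
  \<comment> \<open>Above \<open>i\<close>, one side asks for \<open>k\<close> in
    \<open>fv t\<close>, the other for \<open>Suc (k - 1)\<close>; splitting on \<open>k\<close>
    identifies them.\<close>
  have "k \<in> fv t' \<longleftrightarrow> k \<in> fv (Upd (Lam t) i)" for k
    by (cases k) (auto simp: lam_upd)
  then show ?thesis
    using lam_upd by blast
qed (auto simp: Suc_le_eq less_Suc_eq_le)

lemma root_step_linear: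
  assumes "root_step t t'" "linear t"
  shows "linear t'"
  using assms
proof cases
  \<comment> \<open>Duplicating \<open>t3\<close> is harmless: \<open>fv t1\<close> and
    \<open>fv t2\<close> are disjoint, so \<open>i\<close> lies in at most one of them and at most
    one copy of \<open>t3\<close> contributes indices.\<close>
  case (app_sub t1 t2 t3 i)
  with assms(2) show ?thesis
    by (auto simp: set_eq_iff)
next
  case (lam_sub t1 t2 i)
  \<comment> \<open>A clash at \<open>k\<close> for level \<open>Suc i\<close> would be a clash at
    \<open>k - 1\<close> for level \<open>i\<close> in the redex.\<close>
  have "k - Suc i \<notin> fv t2" if "Suc i \<in> fv t1" "Suc i \<le> k" "Suc k \<in> fv t1" for k
    using that assms(2) lam_sub by (cases k) (auto simp: set_eq_iff)
  with assms(2) lam_sub show ?thesis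
    by (simp add: disjoint_iff)
qed (auto simp: set_eq_iff)

text \<open>Both invariants go through the induction together, because linearity of
  \<open>Lam\<close>, \<open>App\<close> and \<open>Sub\<close> depends on the free indices of their
  subterms.\<close>

lemma red_preserves:
  assumes "t \<rightarrow>\<^sub>\<upsilon> t'" "linear t"
  shows "linear t' \<and> fv t' = fv t"
  using assms
proof induction
  case (root t t')
  then show ?case
    using root_step_linear root_step_fv by blast
qed simp_all

theorem theorem1:
  fixes t t' :: trm and l :: ltype
  assumes "t :\<^sub>L l" and "t \<rightarrow>\<^sub>\<upsilon> t'"
  shows "t' :\<^sub>L l"
  using assms red_preserves[of t t'] by (simp add: typing_iff_linear)

end
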